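(* Let $\mathbb{A}$ be a $k$-letter alphabet and $\pi=(<_D,<_A)$ a pair of distinct total orders on $\mathbb{A}$. (1) Let $\mathcal{F}=(v_1,\ldots,v_n)$ be a family of primitive words over $\mathbb{A}$, and let $T$ denote the discrete $k$-interval exchange transformation with pair of orders $\pi$ and length vector $\lambda(v_1)+\cdots+\lambda(v_n)$. If $\mathcal{F}$ is $\pi$-clustering, then the natural coding of $T$ decomposes into the $n$ trajectories $v_1^\infty,v_2^\infty,\ldots,v_n^\infty$. (2) Conversely, if the natural coding of a discrete $k$-interval exchange transformation $T$ with pair of orders $\pi$ decomposes into $n$ trajectories $v_1^\infty,\ldots,v_n^\infty$ (with each $v_i$ primitive), then the family $\mathcal{F}=(v_1,\ldots,v_n)$ is $\pi$-clustering.
   Context: For a word $w$, $\lambda(w)=(|w|_a)_{a\in\mathbb{A}}$ is its Parikh vector ($|w|_a$ is the number of occurrences of $a$ in $w$). A word is primitive if it is not a proper power; conjugates of a word are its cyclic rotations. For nonempty words $w,z$ put $w^\omega=www\cdots$ and $w^{-\omega}=\cdots www$. Write $w<_D z$ if $w^\omega$ is lexicographically smaller than $z^\omega$ with respect to $<_D$ (reading left to right), and $w<_A z$ if $w^{-\omega}$ is reverse-lexicographically smaller than $z^{-\omega}$ with respect to $<_A$ (reading right to left). A family $\mathcal{F}=(v_1,\ldots,v_n)$ of nonempty words (repetitions allowed) is $\pi$-clustering if for all $1\le i,j\le n$ and all conjugates $u$ of $v_i$ and $v$ of $v_j$, $u<_A v\Leftrightarrow u<_D v$. A discrete $k$-interval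 exchange transformation with pair of orders $\pi$ and length vector $\lambda=(\lambda_a)_{a\in\mathbb{A}}$ (nonnegative integers, with sum $m\ge1$) is the bijection $T:I\to I$ of $I=\{1,\ldots,m\}$ obtained as follows: $I$ is partitioned into $k$ intervals $I_a$ of consecutive integers with $|I_a|=\lambda_a$, placed from left to right in increasing order of $a$ with respect to $<_D$; the images $T(I_a)$ are also intervals partitioning $I$, placed from left to right in increasing order of $a$ with respect to $<_A$; and the restriction of $T$ to each $I_a$ is a translation. The natural coding of the trajectory (orbit) of $x\in I$ is the bi-infinite word $(x_n)_{n\in\mathbb{Z}}$ with $x_n=a$ iff $T^n(x)\in I_a$; it is written $v^\infty=\cdots vvv\cdots$ with $v$ primitive, and is considered up to shift. "The natural coding of $T$ decomposes into $n$ trajectories $v_1^\infty,\ldots,v_n^\infty$" means that $T$ has exactly $n$ orbits and their codings, listed with multiplicity, are $v_1^\infty,\ldots,v_n^\infty$. *)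

theory Defs
  imports Main
begin

text \<open>
  The alphabet is a finite type and a total order on it is given by its strict part, a relation
  satisfying \<^const>\<open>strict_linear_order\<close>.
\<close>

subsection \<open>Words\<close>

definition parikh :: "'a list \<Rightarrow> 'a \<Rightarrow> nat" where
  "parikh w = (\<lambda>a. count_list w a)"

text \<open>The empty word equals its own square, hence is not primitive.\<close>

definition primitive :: "'a list \<Rightarrow> bool" where
  "primitive w \<longleftrightarrow> (\<forall>u n. w = concat (replicate n u) \<longrightarrow> n = 1)"

definition conjugates :: "'a list \<Rightarrow> 'a list set" where
  "conjugates w = {rotate k w |k. True}"

text \<open>
  The next three definitions are meant for nonempty words only. Left-infinite words are indexed
  from right to left: \<open>left_power w n\<close> is the letter of \<open>\<cdots>www\<close> that has exactly \<open>n\<close> letters to its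
  right.
\<close>

definition right_power :: "'a list \<Rightarrow> nat \<Rightarrow> 'a" where
  "right_power w = (\<lambda>n. w ! (n mod length w))"

definition left_power :: "'a list \<Rightarrow> nat \<Rightarrow> 'a" where
  "left_power w = (\<lambda>n. rev w ! (n mod length w))"

definition biinf_power :: "'a list \<Rightarrow> int \<Rightarrow> 'a" where
  "biinf_power w = (\<lambda>n. w ! nat (n mod int (length w)))"

definition lex_less :: "'a rel \<Rightarrow> (nat \<Rightarrow> 'a) \<Rightarrow> (nat \<Rightarrow> 'a) \<Rightarrow> bool" where
  "lex_less r x y \<longleftrightarrow> (\<exists>n. (\<forall>i<n. x i = y i) \<and> (x n, y n) \<in> r)"

definition less_D :: "'a rel \<Rightarrow> 'a list \<Rightarrow> 'a list \<Rightarrow> bool" where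
  "less_D ordD w z \<longleftrightarrow> lex_less ordD (right_power w) (right_power z)"

definition less_A :: "'a rel \<Rightarrow> 'a list \<Rightarrow> 'a list \<Rightarrow> bool" where
  "less_A ordA w z \<longleftrightarrow> lex_less ordA (left_power w) (left_power z)"

definition clustering :: "'a rel \<Rightarrow> 'a rel \<Rightarrow> 'a list list \<Rightarrow> bool" where
  "clustering ordD ordA F \<longleftrightarrow>
     (\<forall>v\<in>set F. v \<noteq> []) \<and>
     (\<forall>i<length F. \<forall>j<length F. \<forall>u\<in>conjugates (F ! i). \<forall>v\<in>conjugates (F ! j).
        less_A ordA u v \<longleftrightarrow> less_D ordD u v)"

subsection \<open>Discrete interval exchange transformations\<close>

definition total_length :: "('a::finite \<Rightarrow> nat) \<Rightarrow> nat" where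
  "total_length lam = (\<Sum>a\<in>UNIV. lam a)"

definition offset :: "'a rel \<Rightarrow> ('a::finite \<Rightarrow> nat) \<Rightarrow> 'a \<Rightarrow> nat" where
  "offset r lam a = (\<Sum>b | (b, a) \<in> r. lam b)"

text \<open>
  Consecutive intervals of lengths \<open>lam a\<close>, placed from left to right in increasing order of \<open>a\<close>
  with respect to \<open>r\<close>. They are the intervals \<open>I\<^sub>a\<close> for \<open>r = ordD\<close> and their images for
  \<open>r = ordA\<close>.
\<close>

definition subinterval :: "'a rel \<Rightarrow> ('a::finite \<Rightarrow> nat) \<Rightarrow> 'a \<Rightarrow> nat set" where
  "subinterval r lam a = {offset r lam a + 1 .. offset r lam a + lam a}"

definition letter_at :: "'a rel \<Rightarrow> ('a::finite \<Rightarrow> nat) \<Rightarrow> nat \<Rightarrow> 'a" where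
  "letter_at ordD lam x = (THE a. x \<in> subinterval ordD lam a)"

text \<open>
  The transformation is extended by the identity outside \<open>{1..total_length lam}\<close>, so that it is a
  bijection of \<^typ>\<open>nat\<close>. The subtraction never truncates, since \<open>x > offset ordD lam a\<close> for
  \<open>x\<close> in \<open>subinterval ordD lam a\<close>.
\<close>

definition diet :: "'a rel \<Rightarrow> 'a rel \<Rightarrow> ('a::finite \<Rightarrow> nat) \<Rightarrow> nat \<Rightarrow> nat" where
  "diet ordD ordA lam x =
     (if x \<in> {1..total_length lam}
      then let a = letter_at ordD lam x in x - offset ordD lam a + offset ordA lam a
      else x)"

definition int_iterate :: "('b \<Rightarrow> 'b) \<Rightarrow> int \<Rightarrow> 'b \<Rightarrow> 'b" where
  "int_iterate T n = (if n \<ge> 0 then T ^^ nat n else inv T ^^ nat (- n))"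

definition int_orbit :: "('b \<Rightarrow> 'b) \<Rightarrow> 'b \<Rightarrow> 'b set" where
  "int_orbit T x = {int_iterate T n x |n. True}"

definition coding :: "'a rel \<Rightarrow> 'a rel \<Rightarrow> ('a::finite \<Rightarrow> nat) \<Rightarrow> nat \<Rightarrow> int \<Rightarrow> 'a" where
  "coding ordD ordA lam x = (\<lambda>n. letter_at ordD lam (int_iterate (diet ordD ordA lam) n x))"

definition shift_equivalent :: "(int \<Rightarrow> 'a) \<Rightarrow> (int \<Rightarrow> 'a) \<Rightarrow> bool" where
  "shift_equivalent x y \<longleftrightarrow> (\<exists>s. \<forall>n. x n = y (n + s))"

text \<open>
  A bijection \<open>f\<close> from the indices of the family to the orbits expresses both the number of orbits
  and the multiplicities of their codings.
\<close>

definition decomposes_into ::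
  "'a rel \<Rightarrow> 'a rel \<Rightarrow> ('a::finite \<Rightarrow> nat) \<Rightarrow> 'a list list \<Rightarrow> bool" where
  "decomposes_into ordD ordA lam F \<longleftrightarrow>
     (\<exists>f. bij_betw f {..<length F} (int_orbit (diet ordD ordA lam) ` {1..total_length lam}) \<and>
          (\<forall>i<length F. \<forall>x\<in>f i.
             shift_equivalent (coding ordD ordA lam x) (biinf_power (F ! i))))"

subsection \<open>The defining properties of a discrete interval exchange\<close>

lemma subinterval_before:
  assumes "strict_linear_order r" "(a, b) \<in> r" "x \<in> subinterval r lam a" "y \<in> subinterval r lam b"
  shows "x < y"
proof -
  have "offset r lam a + lam a = (\<Sum>c\<in>insert a {c. (c, a) \<in> r}. lam c)"
    using assms(1) by (subst sum.insert) (auto simp: offset_def strict_linear_order_on_def irrefl_def)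
  also have "\<dots> \<le> offset r lam b"
    unfolding offset_def using assms(1,2)
    by (intro sum_mono2) (auto simp: strict_linear_order_on_def dest: transD)
  finally show ?thesis
    using assms(3,4) by (auto simp: subinterval_def)
qed

lemma subinterval_disjoint:
  assumes "strict_linear_order r" "a \<noteq> b"
  shows "subinterval r lam a \<inter> subinterval r lam b = {}"
proof -
  have "(a, b) \<in> r \<or> (b, a) \<in> r"
    using assms by (auto simp: strict_linear_order_on_def total_on_def)
  then show ?thesis
    using subinterval_before[OF assms(1)] by (metis disjoint_iff less_asym')
qed

lemma subinterval_cover:
  assumes "strict_linear_order r"
  shows "(\<Union>a. subinterval r lam a) = {1..total_length lam}"
proof (rule card_subset_eq)
  have "offset r lam a + lam a \<le> total_length lam" for a
  proof -
    have "offset r lam a + lam a = (\<Sum>c\<in>insert a {c. (c, a) \<in> r}. lam c)"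
      using assms
      by (subst sum.insert) (auto simp: offset_def strict_linear_order_on_def irrefl_def)
    also have "\<dots> \<le> total_length lam"
      unfolding total_length_def by (intro sum_mono2) auto
    finally show ?thesis .
  qed
  then show "(\<Union>a. subinterval r lam a) \<subseteq> {1..total_length lam}"
    by (fastforce simp: subinterval_def intro: order_trans)
  have "card (\<Union>a. subinterval r lam a) = (\<Sum>a\<in>UNIV. card (subinterval r lam a))"
    using subinterval_disjoint[OF assms]
    by (intro card_UN_disjoint) (auto simp: subinterval_def)
  then show "card (\<Union>a. subinterval r lam a) = card {1..total_length lam}"
    by (simp add: subinterval_def total_length_def)
qed simp

lemma letter_at_eq:
  assumes "strict_linear_order ordD" "x \<in> subinterval ordD lam a"
  shows "letter_at ordD lam x = a"
  unfolding letter_at_def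
  using assms subinterval_disjoint[OF assms(1)] by (intro the_equality) blast+

lemma diet_on_subinterval:
  assumes "strict_linear_order ordD" "x \<in> subinterval ordD lam a"
  shows "diet ordD ordA lam x = x - offset ordD lam a + offset ordA lam a"
  using assms subinterval_cover[OF assms(1), of lam] letter_at_eq[OF assms]
  by (auto simp: diet_def Let_def)

lemma diet_translation:
  assumes "strict_linear_order ordD" "x \<in> subinterval ordD lam a"
  shows "int (diet ordD ordA lam x) = int x + (int (offset ordA lam a) - int (offset ordD lam a))"
  using assms(2) unfolding diet_on_subinterval[OF assms] by (auto simp: subinterval_def)

lemma diet_image_subinterval:
  assumes "strict_linear_order ordD"
  shows "diet ordD ordA lam ` subinterval ordD lam a = subinterval ordA lam a"
proof (intro set_eqI iffI)
  fix y assume "y \<in> diet ordD ordA lam ` subinterval ordD lam a"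
  then show "y \<in> subinterval ordA lam a"
    using diet_on_subinterval[OF assms] by (auto simp: subinterval_def)
next
  fix y assume y: "y \<in> subinterval ordA lam a"
  define x where "x = y - offset ordA lam a + offset ordD lam a"
  have x: "x \<in> subinterval ordD lam a"
    using y by (auto simp: x_def subinterval_def)
  moreover have "diet ordD ordA lam x = y"
    using y unfolding diet_on_subinterval[OF assms x] by (auto simp: x_def subinterval_def)
  ultimately show "y \<in> diet ordD ordA lam ` subinterval ordD lam a"
    by blast
qed

lemma diet_bij_betw:
  assumes "strict_linear_order ordD" "strict_linear_order ordA"
  shows "bij_betw (diet ordD ordA lam) {1..total_length lam} {1..total_length lam}"
proof -
  have "diet ordD ordA lam ` {1..total_length lam} = {1..total_length lam}"
    unfolding subinterval_cover[OF assms(1), symmetric] image_UN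
      diet_image_subinterval[OF assms(1)]
    unfolding subinterval_cover[OF assms(1)] subinterval_cover[OF assms(2)] ..
  then show ?thesis
    by (simp add: bij_betw_def eq_card_imp_inj_on)
qed

lemma diet_bij:
  assumes "strict_linear_order ordD" "strict_linear_order ordA"
  shows "bij (diet ordD ordA lam)"
proof -
  have "bij_betw (diet ordD ordA lam) (- {1..total_length lam}) (- {1..total_length lam})"
    by (rule bij_betw_cong[THEN iffD2, OF _ bij_betw_id]) (auto simp: diet_def)
  from bij_betw_combine[OF diet_bij_betw[OF assms] this] show ?thesis
    by simp
qed

end

theory Submission
  imports Defs
begin

text \<open>
  Both directions read a point of an interval exchange as a bi-infinite word whose future is
  compared with \<open>ordD\<close> and whose past with \<open>ordA\<close>.

  From an interval exchange to clustering (\<open>decomposes_into_imp_clustering\<close>): two points keep their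
  signed distance while they read equal letters. At the first future letter where they differ they
  lie in different intervals, whose order is \<open>ordD\<close>; at the first past letter where they differ they
  come from different intervals, and the images of these are ordered by \<open>ordA\<close>. Hence \<open>u <\<^sub>D v\<close> and
  \<open>u <\<^sub>A v\<close> each put the point coded by \<open>u\<close> to the left of the point coded by \<open>v\<close>. The two
  comparisons cannot contradict each other, and for periodic words equal futures mean equal pasts, so
  either comparison implies the other.

  From clustering to an interval exchange (\<open>clustering_imp_decomposes_into\<close>): the conjugates of the
  words of the family, one for each position \<open>(i, k)\<close>, are sorted by \<open><\<^sub>D\<close>. In this order the
  conjugates with a given first letter form a block, the blocks being placed according to \<open>ordD\<close>. By
  clustering the order is also \<open><\<^sub>A\<close>, so the conjugates with a given last letter form blocks placed
  according to \<open>ordA\<close>. Moving the first letter to the end maps blocks of the first kind to blocks of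
  the second kind, and it preserves the order within a block because deleting a common first letter
  does not change a lexicographic comparison. So this cyclic rotation, seen on ranks, is the discrete
  interval exchange (\<open>rank_conjugates_to_diet\<close>), and its cycles are the words of the family.
\<close>

section \<open>Powers of words\<close>

lemma right_power_eq_biinf: "right_power w n = biinf_power w (int n)"
  by (simp add: right_power_def biinf_power_def nat_mod_distrib)

lemma left_power_eq_biinf:
  assumes "w \<noteq> []"
  shows "left_power w n = biinf_power w (- 1 - int n)"
proof -
  define l where "l = length w"
  have l: "0 < l" using assms by (simp add: l_def)
  define r where "r = n mod l"
  have r: "r < l" using l by (simp add: r_def)
  have "(- 1 - int n) mod int l = (- 1 - int r) mod int l"
    by (simp add: r_def zmod_int mod_diff_right_eq)
  also have "\<dots> = (- 1 - int r + int l) mod int l"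
    by simp
  also have "\<dots> = int (l - Suc r)"
    using r by (subst mod_pos_pos_trivial) (auto simp: of_nat_diff)
  finally have "nat ((- 1 - int n) mod int l) = l - Suc r" by simp
  then show ?thesis
    using r by (simp add: left_power_def biinf_power_def rev_nth flip: l_def r_def)
qed

lemma biinf_power_rotate:
  assumes "w \<noteq> []"
  shows "biinf_power (rotate k w) n = biinf_power w (n + int k)"
proof -
  have "nat (n mod int (length w)) < length w"
    using assms by (simp add: nat_less_iff)
  then have "biinf_power (rotate k w) n = w ! ((k + nat (n mod int (length w))) mod length w)"
    by (simp add: biinf_power_def nth_rotate)
  also have "(k + nat (n mod int (length w))) mod length w
      = nat ((int k + n mod int (length w)) mod int (length w))"
    using assms by (simp add: nat_mod_distrib nat_add_distrib)
  also have "\<dots> = nat ((n + int k) mod int (length w))"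
    by (simp add: mod_add_right_eq add.commute)
  finally show ?thesis by (simp add: biinf_power_def)
qed

lemma biinf_power_periodic: "biinf_power w (n + int (length w) * j) = biinf_power w n"
  by (simp add: biinf_power_def)

text \<open>
  Both bi-infinite words have the period \<open>|u| |v|\<close>, so a translation by a large multiple of it
  carries any position into a prescribed half-line, where the two words agree.
\<close>

lemma biinf_power_eqI:
  assumes "u \<noteq> []" "v \<noteq> []"
    and "(\<forall>n\<ge>0. biinf_power u n = biinf_power v n) \<or> (\<forall>n<0. biinf_power u n = biinf_power v n)"
  shows "biinf_power u = biinf_power v"
proof
  fix n :: int
  define p where "p = int (length u) * int (length v)"
  have p: "p \<ge> 1" using assms(1,2) by (simp add: p_def Suc_le_eq int_one_le_iff_zero_less)
  have per: "biinf_power u (n + p * j) = biinf_power u n" "biinf_power v (n + p * j) = biinf_power v n"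
    for j
    using biinf_power_periodic[of u n "int (length v) * j"]
      biinf_power_periodic[of v n "int (length u) * j"]
    by (simp_all add: p_def ac_simps)
  have "p * (\<bar>n\<bar> + 1) \<ge> 1 * (\<bar>n\<bar> + 1)"
    using p by (intro mult_right_mono) auto
  then have "n + p * (\<bar>n\<bar> + 1) \<ge> 0" "n + p * (- (\<bar>n\<bar> + 1)) < 0"
    by (auto simp: algebra_simps)
  then show "biinf_power u n = biinf_power v n"
    using assms(3) per by metis
qed

lemma right_power_eq_iff_biinf:
  assumes "u \<noteq> []" "v \<noteq> []"
  shows "right_power u = right_power v \<longleftrightarrow> biinf_power u = biinf_power v"
proof
  assume "right_power u = right_power v"
  then have "biinf_power u (int n) = biinf_power v (int n)" for n
    by (metis right_power_eq_biinf)
  then show "biinf_power u = biinf_power v"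
    using assms by (intro biinf_power_eqI) (auto dest: zero_le_imp_eq_int)
qed (auto simp: right_power_eq_biinf fun_eq_iff)

lemma left_power_eq_iff_biinf:
  assumes "u \<noteq> []" "v \<noteq> []"
  shows "left_power u = left_power v \<longleftrightarrow> biinf_power u = biinf_power v"
proof
  assume "left_power u = left_power v"
  then have eq: "biinf_power u (- 1 - int n) = biinf_power v (- 1 - int n)" for n
    using assms by (metis left_power_eq_biinf)
  have "biinf_power u n = biinf_power v n" if "n < 0" for n
    using eq[of "nat (- 1 - n)"] that by simp
  then show "biinf_power u = biinf_power v"
    using assms by (intro biinf_power_eqI) auto
qed (auto simp: left_power_eq_biinf assms fun_eq_iff)

lemma primitive_imp_nonempty:
  assumes "primitive w"
  shows "w \<noteq> []"
proof
  assume "w = []"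
  then have "w = concat (replicate 0 [])" by simp
  with assms show False unfolding primitive_def by (metis zero_neq_one)
qed

text \<open>
  A nontrivial rotation fixing a word splits it into two commuting nonempty factors, and commuting
  words are powers of a common word.
\<close>

lemma primitive_rotate_eq_self:
  assumes "primitive w" "d < length w" "rotate d w = w"
  shows "d = 0"
proof -
  have "take d w @ drop d w = drop d w @ take d w"
    using assms(2,3) by (simp add: rotate_drop_take)
  then obtain m n z where z: "concat (replicate m z) = take d w" "concat (replicate n z) = drop d w"
    using comm_append_are_replicate by blast
  then have "w = concat (replicate (m + n) z)"
    by (simp add: replicate_add)
  with assms(1) have "m + n = 1" unfolding primitive_def by blast
  with z assms(2) show ?thesis by (cases m) auto
qed

lemma right_power_eq_imp_eq:
  assumes "length u = length v" "right_power u = right_power v"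
  shows "u = v"
proof (rule nth_equalityI)
  fix i assume "i < length u"
  then show "u ! i = v ! i"
    using assms(1) fun_cong[OF assms(2), of i] by (simp add: right_power_def)
qed (fact assms(1))

lemma primitive_rotate_inj:
  assumes "primitive w" "k < length w" "l < length w" "rotate k w = rotate l w"
  shows "k = l"
proof -
  have "k = l" if "k \<le> l" "l < length w" "rotate k w = rotate l w" for k l
  proof -
    define e where "e = length w - k"
    have e: "e + k = length w" "e + l = l - k + length w" using that by (simp_all add: e_def)
    have "rotate e (rotate k w) = w"
      by (simp add: rotate_rotate e)
    moreover have "rotate e (rotate l w) = rotate (l - k) (rotate (length w) w)"
      by (simp only: rotate_rotate e)
    ultimately have "rotate (l - k) w = w" using that(3) by simp
    moreover have "l - k < length w" using that(2) by simp
    ultimately show ?thesis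
      using primitive_rotate_eq_self[OF assms(1)] that(1) by (metis diff_is_0_eq le_antisym)
  qed
  from this[of k l] this[of l k] show ?thesis
    using assms(2-4) by (cases "k \<le> l") auto
qed

section \<open>Lexicographic order\<close>

lemma lex_less_total:
  assumes "strict_linear_order r" "x \<noteq> y"
  shows "lex_less r x y \<or> lex_less r y x"
proof -
  define n where "n = (LEAST n. x n \<noteq> y n)"
  from assms(2) obtain k where "x k \<noteq> y k" by auto
  then have "x n \<noteq> y n" unfolding n_def by (rule LeastI)
  then have "(x n, y n) \<in> r \<or> (y n, x n) \<in> r"
    using assms(1) by (auto simp: strict_linear_order_on_def total_on_def)
  moreover have "\<forall>i<n. x i = y i"
    using not_less_Least n_def by blast
  ultimately show ?thesis unfolding lex_less_def by metis
qed

lemma lex_less_irrefl: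
  assumes "strict_linear_order r"
  shows "\<not> lex_less r x x"
  using assms by (auto simp: lex_less_def strict_linear_order_on_def irrefl_def)

lemma lex_less_trans:
  assumes r: "strict_linear_order r" and "lex_less r x y" "lex_less r y z"
  shows "lex_less r x z"
proof -
  obtain m n where m: "\<forall>i<m. x i = y i" "(x m, y m) \<in> r"
    and n: "\<forall>i<n. y i = z i" "(y n, z n) \<in> r"
    using assms(2,3) unfolding lex_less_def by blast
  have "(x (min m n), z (min m n)) \<in> r"
    using m n r unfolding strict_linear_order_on_def
    by (cases m n rule: linorder_cases) (auto dest: transD)
  then show ?thesis
    using m(1) n(1) unfolding lex_less_def by (intro exI[of _ "min m n"]) auto
qed

lemma lex_less_iff_head_tail:
  "lex_less r x y \<longleftrightarrow>
     (x 0, y 0) \<in> r \<or> x 0 = y 0 \<and> lex_less r (\<lambda>n. x (Suc n)) (\<lambda>n. y (Suc n))"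
proof
  assume "lex_less r x y"
  then obtain n where n: "\<forall>i<n. x i = y i" "(x n, y n) \<in> r"
    unfolding lex_less_def by blast
  then show "(x 0, y 0) \<in> r \<or> x 0 = y 0 \<and> lex_less r (\<lambda>n. x (Suc n)) (\<lambda>n. y (Suc n))"
    by (cases n) (auto 4 4 simp: lex_less_def)
next
  assume "(x 0, y 0) \<in> r \<or> x 0 = y 0 \<and> lex_less r (\<lambda>n. x (Suc n)) (\<lambda>n. y (Suc n))"
  then show "lex_less r x y"
  proof
    assume "(x 0, y 0) \<in> r"
    then show ?thesis unfolding lex_less_def by (intro exI[of _ 0]) auto
  next
    assume a: "x 0 = y 0 \<and> lex_less r (\<lambda>n. x (Suc n)) (\<lambda>n. y (Suc n))"
    then obtain n where "\<forall>i<n. x (Suc i) = y (Suc i)" "(x (Suc n), y (Suc n)) \<in> r"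
      unfolding lex_less_def by blast
    with a show ?thesis unfolding lex_less_def
      by (intro exI[of _ "Suc n"]) (auto simp: less_Suc_eq_0_disj)
  qed
qed

lemma lex_less_if_head_less: "(x 0, y 0) \<in> r \<Longrightarrow> lex_less r x y"
  by (subst lex_less_iff_head_tail) simp

section \<open>Orbits of a bijection\<close>

text \<open>
  Recognises a two-sided trajectory from its recurrence alone, so that negative times need no
  treatment of the inverse.
\<close>

lemma int_iterate_unique:
  assumes "bij T" "\<And>n. T (g n) = g (n + 1)"
  shows "int_iterate T n (g 0) = g n"
proof -
  have fwd: "(T ^^ m) (g j) = g (j + int m)" for m j
    by (induction m) (auto simp: assms(2) ac_simps)
  have bwd: "(inv T ^^ m) (g 0) = g (- int m)" for m
  proof (induction m)
    case (Suc m)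
    have "g (- int m) = T (g (- int (Suc m)))" by (simp add: assms(2))
    with Suc show ?case using assms(1) by (simp add: bij_is_inj)
  qed simp
  show ?thesis
    using fwd[of "nat n" 0] bwd[of "nat (- n)"] by (simp add: int_iterate_def)
qed

lemma int_iterate_0 [simp]: "int_iterate T 0 x = x"
  by (simp add: int_iterate_def)

lemma apply_int_iterate:
  assumes "bij T"
  shows "T (int_iterate T n x) = int_iterate T (n + 1) x"
proof (cases "n \<ge> 0")
  case True
  then show ?thesis by (simp add: int_iterate_def nat_add_distrib)
next
  case False
  define m where "m = nat (- n - 1)"
  have n: "n = - int (Suc m)" using False by (simp add: m_def)
  have "T (int_iterate T n x) = (inv T ^^ m) x"
    using assms by (simp add: n int_iterate_def surj_f_inv_f bij_is_surj nat_add_distrib)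
  also have "\<dots> = int_iterate T (n + 1) x"
    by (cases m) (simp_all add: n int_iterate_def nat_add_distrib)
  finally show ?thesis .
qed

lemma int_iterate_add:
  assumes "bij T"
  shows "int_iterate T n (int_iterate T s x) = int_iterate T (n + s) x"
  using int_iterate_unique[OF assms, of "\<lambda>n. int_iterate T (n + s) x"]
  by (simp add: apply_int_iterate[OF assms] ac_simps)

lemma int_iterate_in:
  assumes "bij T" "bij_betw T A A" "x \<in> A"
  shows "int_iterate T n x \<in> A"
proof -
  have "T y \<in> A" if "y \<in> A" for y using assms(2) that by (rule bij_betw_apply)
  moreover have "inv T y \<in> A" if "y \<in> A" for y
    using assms(1,2) that by (metis bij_betw_def bij_is_inj imageE inv_f_f)
  ultimately have "(T ^^ m) x \<in> A" "(inv T ^^ m) x \<in> A" for m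
    by (induction m) (use assms(3) in auto)
  then show ?thesis by (simp add: int_iterate_def)
qed

section \<open>Codings and the order of points\<close>

context
  fixes ordD ordA :: "'a::finite rel" and lam :: "'a \<Rightarrow> nat"
  assumes ordD: "strict_linear_order ordD" and ordA: "strict_linear_order ordA"
begin

lemma coding_shift:
  "coding ordD ordA lam (int_iterate (diet ordD ordA lam) s x) n = coding ordD ordA lam x (n + s)"
  by (simp add: coding_def int_iterate_add[OF diet_bij[OF ordD ordA]])

lemma iterate_in_coded_subinterval:
  assumes "x \<in> {1..total_length lam}"
  shows "int_iterate (diet ordD ordA lam) n x \<in> subinterval ordD lam (coding ordD ordA lam x n)"
proof -
  have "int_iterate (diet ordD ordA lam) n x \<in> {1..total_length lam}"
    by (rule int_iterate_in[OF diet_bij diet_bij_betw assms]) (rule ordD ordA)+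
  then show ?thesis
    unfolding subinterval_cover[OF ordD, symmetric] coding_def
    using letter_at_eq[OF ordD] by fastforce
qed

lemma next_iterate_in_coded_subinterval:
  assumes "x \<in> {1..total_length lam}"
  shows "int_iterate (diet ordD ordA lam) (n + 1) x \<in> subinterval ordA lam (coding ordD ordA lam x n)"
  using imageI[OF iterate_in_coded_subinterval[OF assms, of n], of "diet ordD ordA lam"]
  unfolding diet_image_subinterval[OF ordD] apply_int_iterate[OF diet_bij[OF ordD ordA]] .

text \<open>
  The transformation translates each interval, so two points keep their signed distance as long as
  their trajectories read the same letters, forwards or backwards.
\<close>

lemma iterate_distance_step:
  assumes "x \<in> {1..total_length lam}" "y \<in> {1..total_length lam}"
    and "coding ordD ordA lam x n = coding ordD ordA lam y n"
  shows "int (int_iterate (diet ordD ordA lam) (n + 1) x) - int (int_iterate (diet ordD ordA lam) (n + 1) y)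
       = int (int_iterate (diet ordD ordA lam) n x) - int (int_iterate (diet ordD ordA lam) n y)"
  using diet_translation[OF ordD iterate_in_coded_subinterval[OF assms(1), of n], of ordA]
    diet_translation[OF ordD iterate_in_coded_subinterval[OF assms(2), of n], of ordA] assms(3)
  by (simp add: apply_int_iterate[OF diet_bij[OF ordD ordA]])

text \<open>
  At the first time when the letters differ the current points lie in intervals ordered by \<open>ordD\<close>, and
  up to then their distance is the initial one.
\<close>

lemma future_lex_less_imp_less:
  assumes x: "x \<in> {1..total_length lam}" and y: "y \<in> {1..total_length lam}"
    and "lex_less ordD (\<lambda>n. coding ordD ordA lam x (int n)) (\<lambda>n. coding ordD ordA lam y (int n))"
  shows "x < y"
proof -
  obtain n where eq: "\<forall>i<n. coding ordD ordA lam x (int i) = coding ordD ordA lam y (int i)"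
    and less: "(coding ordD ordA lam x (int n), coding ordD ordA lam y (int n)) \<in> ordD"
    using assms(3) unfolding lex_less_def by blast
  have "int (int_iterate (diet ordD ordA lam) (int m) x) - int (int_iterate (diet ordD ordA lam) (int m) y)
      = int x - int y" if "m \<le> n" for m
    using that
  proof (induction m)
    case (Suc m)
    then show ?case
      using iterate_distance_step[OF x y, of "int m"] eq by (simp add: ac_simps)
  qed simp
  moreover have "int_iterate (diet ordD ordA lam) (int n) x < int_iterate (diet ordD ordA lam) (int n) y"
    by (rule subinterval_before[OF ordD less]) (rule iterate_in_coded_subinterval; fact)+
  ultimately show ?thesis by force
qed

text \<open>
  Going backwards, the letter at time \<open>- 1 - n\<close> tells the image interval that contains the point at
  time \<open>- n\<close>, and image intervals are ordered by \<open>ordA\<close>.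
\<close>

lemma past_lex_less_imp_less:
  assumes x: "x \<in> {1..total_length lam}" and y: "y \<in> {1..total_length lam}"
    and "lex_less ordA (\<lambda>n. coding ordD ordA lam x (- 1 - int n))
           (\<lambda>n. coding ordD ordA lam y (- 1 - int n))"
  shows "x < y"
proof -
  obtain n where
      eq: "\<forall>i<n. coding ordD ordA lam x (- 1 - int i) = coding ordD ordA lam y (- 1 - int i)"
    and less: "(coding ordD ordA lam x (- 1 - int n), coding ordD ordA lam y (- 1 - int n)) \<in> ordA"
    using assms(3) unfolding lex_less_def by blast
  have "int (int_iterate (diet ordD ordA lam) (- int m) x)
        - int (int_iterate (diet ordD ordA lam) (- int m) y)
      = int x - int y" if "m \<le> n" for m
    using that
  proof (induction m)
    case (Suc m)
    then show ?case
      using iterate_distance_step[OF x y, of "- 1 - int m"] eq by simp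
  qed simp
  moreover have "int_iterate (diet ordD ordA lam) (- int n) x < int_iterate (diet ordD ordA lam) (- int n) y"
    using next_iterate_in_coded_subinterval[OF x, of "- 1 - int n"]
      next_iterate_in_coded_subinterval[OF y, of "- 1 - int n"]
    by (intro subinterval_before[OF ordA less]) simp_all
  ultimately show ?thesis by force
qed

section \<open>Interval exchanges yield clustering families\<close>

text \<open>
  A conjugate of a word of the family is read, from time \<open>0\<close> on, by a suitable point of the orbit that
  is coded by this word, since moving along the orbit shifts the coding.
\<close>

lemma conjugate_coding:
  assumes dec: "bij_betw f {..<length F} (int_orbit (diet ordD ordA lam) ` {1..total_length lam})"
      "\<forall>i<length F. \<forall>x\<in>f i. shift_equivalent (coding ordD ordA lam x) (biinf_power (F ! i))"
    and "i < length F" "F ! i \<noteq> []" "u \<in> conjugates (F ! i)"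
  obtains x where "x \<in> {1..total_length lam}" "coding ordD ordA lam x = biinf_power u"
proof -
  let ?T = "diet ordD ordA lam"
  obtain x where x: "x \<in> {1..total_length lam}" "f i = int_orbit ?T x"
    using dec(1) assms(3) by (auto dest!: bij_betw_apply)
  have "int_iterate ?T 0 x \<in> f i" unfolding x(2) int_orbit_def by blast
  then obtain s where s: "\<And>n. coding ordD ordA lam x n = biinf_power (F ! i) (n + s)"
    using dec(2) assms(3) unfolding shift_equivalent_def int_iterate_0 by blast
  obtain k where k: "u = rotate k (F ! i)"
    using assms(5) by (auto simp: conjugates_def)
  show thesis
  proof
    show "int_iterate ?T (int k - s) x \<in> {1..total_length lam}"
      by (rule int_iterate_in[OF diet_bij diet_bij_betw x(1)]) (rule ordD ordA)+
    show "coding ordD ordA lam (int_iterate ?T (int k - s) x) = biinf_power u"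
      by (rule ext) (simp add: coding_shift s k biinf_power_rotate[OF assms(4)])
  qed
qed

text \<open>
  Each of \<open>u <\<^sub>D v\<close> and \<open>u <\<^sub>A v\<close> forces the point coded by \<open>u\<close> to lie to the left of the one coded
  by \<open>v\<close>. As the two orders moreover leave the same pairs of periodic words incomparable, they
  coincide.
\<close>

lemma decomposes_into_imp_clustering:
  assumes "\<forall>v\<in>set F. v \<noteq> []" and "decomposes_into ordD ordA lam F"
  shows "clustering ordD ordA F"
  unfolding clustering_def
proof (intro conjI allI impI ballI)
  fix i j u v
  assume ij: "i < length F" "j < length F" and uv: "u \<in> conjugates (F ! i)" "v \<in> conjugates (F ! j)"
  obtain f where f: "bij_betw f {..<length F} (int_orbit (diet ordD ordA lam) ` {1..total_length lam})"
      "\<forall>i<length F. \<forall>x\<in>f i. shift_equivalent (coding ordD ordA lam x) (biinf_power (F ! i))"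
    using assms(2) unfolding decomposes_into_def by blast
  have ne: "F ! i \<noteq> []" "F ! j \<noteq> []" using assms(1) ij by auto
  then have uv_ne: "u \<noteq> []" "v \<noteq> []" using uv by (auto simp: conjugates_def)
  obtain x where x: "x \<in> {1..total_length lam}" "coding ordD ordA lam x = biinf_power u"
    using conjugate_coding[OF f ij(1) ne(1) uv(1)] .
  obtain y where y: "y \<in> {1..total_length lam}" "coding ordD ordA lam y = biinf_power v"
    using conjugate_coding[OF f ij(2) ne(2) uv(2)] .
  have right: "right_power u = (\<lambda>n. coding ordD ordA lam x (int n))"
      "right_power v = (\<lambda>n. coding ordD ordA lam y (int n))"
    by (simp_all add: x y right_power_eq_biinf fun_eq_iff)
  have left: "left_power u = (\<lambda>n. coding ordD ordA lam x (- 1 - int n))"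
      "left_power v = (\<lambda>n. coding ordD ordA lam y (- 1 - int n))"
    by (simp_all add: x y left_power_eq_biinf uv_ne fun_eq_iff)
  have D: "less_D ordD u v \<Longrightarrow> x < y" "less_D ordD v u \<Longrightarrow> y < x"
    unfolding less_D_def right
    using future_lex_less_imp_less[OF x(1) y(1)] future_lex_less_imp_less[OF y(1) x(1)] by blast+
  have A: "less_A ordA u v \<Longrightarrow> x < y" "less_A ordA v u \<Longrightarrow> y < x"
    unfolding less_A_def left
    using past_lex_less_imp_less[OF x(1) y(1)] past_lex_less_imp_less[OF y(1) x(1)] by blast+
  have eq: "right_power u = right_power v \<longleftrightarrow> left_power u = left_power v"
    by (simp add: right_power_eq_iff_biinf left_power_eq_iff_biinf uv_ne)
  show "less_A ordA u v \<longleftrightarrow> less_D ordD u v"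
  proof
    assume a: "less_A ordA u v"
    then have "right_power u \<noteq> right_power v"
      using eq lex_less_irrefl[OF ordA] by (auto simp: less_A_def)
    with lex_less_total[OF ordD] have "less_D ordD u v \<or> less_D ordD v u"
      by (auto simp: less_D_def)
    with a A D show "less_D ordD u v" by force
  next
    assume d: "less_D ordD u v"
    then have "left_power u \<noteq> left_power v"
      using eq lex_less_irrefl[OF ordD] by (auto simp: less_D_def)
    with lex_less_total[OF ordA] have "less_A ordA u v \<or> less_A ordA v u"
      by (auto simp: less_A_def)
    with d A D show "less_A ordA u v" by force
  qed
qed (use assms(1) in auto)

end

section \<open>Ranking a labelled permutation\<close>

definition rank :: "('p \<Rightarrow> 'p \<Rightarrow> bool) \<Rightarrow> 'p set \<Rightarrow> 'p \<Rightarrow> nat" where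
  "rank R P p = Suc (card {q \<in> P. R q p})"

lemma rank_bij_betw:
  assumes "finite P"
    and irrefl: "\<And>p. p \<in> P \<Longrightarrow> \<not> R p p"
    and trans: "\<And>p q r. p \<in> P \<Longrightarrow> q \<in> P \<Longrightarrow> r \<in> P \<Longrightarrow> R p q \<Longrightarrow> R q r \<Longrightarrow> R p r"
    and total: "\<And>p q. p \<in> P \<Longrightarrow> q \<in> P \<Longrightarrow> p \<noteq> q \<Longrightarrow> R p q \<or> R q p"
  shows "bij_betw (rank R P) P {1..card P}"
proof -
  have less: "rank R P p < rank R P q" if "p \<in> P" "q \<in> P" "R p q" for p q
  proof -
    have "{r \<in> P. R r p} \<subset> {r \<in> P. R r q}"
      using that irrefl trans by blast
    then show ?thesis
      unfolding rank_def using assms(1) by (intro Suc_mono psubset_card_mono) auto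
  qed
  have inj: "inj_on (rank R P) P"
    using less total by (intro inj_onI) (metis less_irrefl)
  have "rank R P p \<in> {1..card P}" if "p \<in> P" for p
  proof -
    have "{q \<in> P. R q p} \<subset> P" using that irrefl by blast
    then have "card {q \<in> P. R q p} < card P" using assms(1) by (rule psubset_card_mono[rotated])
    then show ?thesis by (simp add: rank_def)
  qed
  then have "rank R P ` P \<subseteq> {1..card P}" by blast
  then have "rank R P ` P = {1..card P}"
    by (intro card_subset_eq) (simp_all add: card_image[OF inj])
  with inj show ?thesis by (simp add: bij_betw_def)
qed

lemma card_labels:
  fixes lam :: "'a::finite \<Rightarrow> nat"
  assumes "finite P" "\<And>a. card {p \<in> P. c p = a} = lam a"
  shows "card {p \<in> P. c p \<in> B} = (\<Sum>b\<in>B. lam b)"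
proof -
  have "{p \<in> P. c p \<in> B} = (\<Union>b\<in>B. {p \<in> P. c p = b})" by blast
  then have "card {p \<in> P. c p \<in> B} = (\<Sum>b\<in>B. card {p \<in> P. c p = b})"
    using assms(1) by (simp only:) (rule card_UN_disjoint; auto)
  then show ?thesis by (simp add: assms(2))
qed

text \<open>
  In an order that sorts the points by their label, the points to the left of \<open>p\<close> are all those with
  a smaller label, counted by the offset, and the smaller ones with the label of \<open>p\<close>.
\<close>

lemma rank_eq_offset:
  fixes lam :: "'a::finite \<Rightarrow> nat"
  assumes "finite P" "strict_linear_order r" "\<And>a. card {p \<in> P. c p = a} = lam a"
    and irrefl: "\<And>p. p \<in> P \<Longrightarrow> \<not> R p p"
    and trans: "\<And>p q r. p \<in> P \<Longrightarrow> q \<in> P \<Longrightarrow> r \<in> P \<Longrightarrow> R p q \<Longrightarrow> R q r \<Longrightarrow> R p r"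
    and sorted: "\<And>p q. p \<in> P \<Longrightarrow> q \<in> P \<Longrightarrow> (c p, c q) \<in> r \<Longrightarrow> R p q"
    and "p \<in> P"
  shows "rank R P p = offset r lam (c p) + rank R {q \<in> P. c q = c p} p"
proof -
  have "(c q, c p) \<in> r \<or> c q = c p" if "q \<in> P" "R q p" for q
    using assms(2) that sorted[of p q] irrefl[of q] trans[of q p q] \<open>p \<in> P\<close>
    by (auto simp: strict_linear_order_on_def total_on_def)
  then have "{q \<in> P. R q p} = {q \<in> P. c q \<in> {b. (b, c p) \<in> r}} \<union> {q \<in> {q \<in> P. c q = c p}. R q p}"
    using sorted \<open>p \<in> P\<close> by auto
  moreover have "{q \<in> P. c q \<in> {b. (b, c p) \<in> r}} \<inter> {q \<in> {q \<in> P. c q = c p}. R q p} = {}"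
    using assms(2) by (auto simp: strict_linear_order_on_def irrefl_def)
  ultimately have "card {q \<in> P. R q p}
      = card {q \<in> P. c q \<in> {b. (b, c p) \<in> r}} + card {q \<in> {q \<in> P. c q = c p}. R q p}"
    using assms(1) by (simp add: card_Un_disjoint)
  also have "card {q \<in> P. c q \<in> {b. (b, c p) \<in> r}} = offset r lam (c p)"
    using card_labels[OF assms(1), of c lam] assms(3) unfolding offset_def by blast
  finally show ?thesis by (simp add: rank_def)
qed

text \<open>
  A combinatorial characterisation of discrete interval exchanges: a permutation \<open>S\<close> of a finite
  ordered set with labels is one, up to the order isomorphism with an initial segment, as soon as
  points are sorted by their label with respect to \<open>ordD\<close>, their images are sorted by the label of
  the preimage with respect to \<open>ordA\<close>, and \<open>S\<close> is increasing on points with a common label. Indeed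
  a point with label \<open>a\<close> has as many points to the left of it within its label class as its image
  has within the image of that class; only the offset of the class changes.
\<close>

lemma rank_conjugates_to_diet:
  fixes lam :: "'a::finite \<Rightarrow> nat"
  assumes ordD: "strict_linear_order ordD" and ordA: "strict_linear_order ordA"
    and P: "finite P" "\<And>a. card {p \<in> P. c p = a} = lam a"
    and S: "bij_betw S P P"
    and irrefl: "\<And>p. p \<in> P \<Longrightarrow> \<not> R p p"
    and trans: "\<And>p q r. p \<in> P \<Longrightarrow> q \<in> P \<Longrightarrow> r \<in> P \<Longrightarrow> R p q \<Longrightarrow> R q r \<Longrightarrow> R p r"
    and D: "\<And>p q. p \<in> P \<Longrightarrow> q \<in> P \<Longrightarrow> (c p, c q) \<in> ordD \<Longrightarrow> R p q"
    and A: "\<And>p q. p \<in> P \<Longrightarrow> q \<in> P \<Longrightarrow> (c p, c q) \<in> ordA \<Longrightarrow> R (S p) (S q)"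
    and mono: "\<And>p q. p \<in> P \<Longrightarrow> q \<in> P \<Longrightarrow> c p = c q \<Longrightarrow> R (S p) (S q) \<longleftrightarrow> R p q"
    and p: "p \<in> P"
  shows "rank R P p \<in> subinterval ordD lam (c p)"
    and "diet ordD ordA lam (rank R P p) = rank R P (S p)"
proof -
  define a where "a = c p"
  \<comment> \<open>The image of a point carries the label of that point when the order is read with \<open>ordA\<close>, so the
    relevant labelling of the images is \<open>c \<circ> S'\<close>.\<close>
  define S' where "S' = inv_into P S"
  have S': "S' (S q) = q" if "q \<in> P" for q
    using S that by (auto simp: S'_def bij_betw_def)
  have SS': "S (S' q) = q" "S' q \<in> P" if "q \<in> P" for q
    using S that by (auto simp: S'_def bij_betw_def f_inv_into_f inv_into_into)
  have SP: "S q \<in> P" if "q \<in> P" for q using S that by (rule bij_betw_apply)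
  have image: "{q \<in> P. c (S' q) = b} = S ` {q \<in> P. c q = b}" for b
  proof -
    have "q \<in> S ` {q \<in> P. c q = b}" if "q \<in> P" "c (S' q) = b" for q
      using that SS'[OF that(1)] by (intro image_eqI[of _ _ "S' q"]) auto
    then show ?thesis using S' SP by auto
  qed
  have inj: "inj_on S X" if "X \<subseteq> P" for X
    using S that by (auto simp: bij_betw_def intro: inj_on_subset)
  have rank_p: "rank R P p = offset ordD lam a + rank R {q \<in> P. c q = a} p"
    unfolding a_def by (rule rank_eq_offset[OF P(1) ordD P(2) irrefl trans D p])
  have "rank R P (S p) = offset ordA lam a + rank R {q \<in> P. c (S' q) = a} (S p)"
  proof -
    have "card {q \<in> P. c (S' q) = b} = lam b" for b
      unfolding image using P(2) inj by (subst card_image) auto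
    moreover have "R q r" if "q \<in> P" "r \<in> P" "(c (S' q), c (S' r)) \<in> ordA" for q r
      using A[of "S' q" "S' r"] SS' that by simp
    ultimately have "rank R P (S p)
        = offset ordA lam (c (S' (S p))) + rank R {q \<in> P. c (S' q) = c (S' (S p))} (S p)"
      by (intro rank_eq_offset[OF P(1) ordA]) (use irrefl SP[OF p] in \<open>auto intro: trans\<close>)
    then show ?thesis by (simp only: S'[OF p] a_def)
  qed
  also have "rank R {q \<in> P. c (S' q) = a} (S p) = rank R {q \<in> P. c q = a} p"
  proof -
    have "{r \<in> S ` {q \<in> P. c q = a}. R r (S p)} = S ` {q \<in> {q \<in> P. c q = a}. R q p}"
      using mono p by (auto simp: a_def)
    then show ?thesis
      unfolding rank_def image using inj by (simp add: card_image subset_eq)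
  qed
  finally have rank_Sp: "rank R P (S p) = offset ordA lam a + rank R {q \<in> P. c q = a} p" .
  have "{q \<in> {q \<in> P. c q = a}. R q p} \<subset> {q \<in> P. c q = a}"
    using p irrefl by (auto simp: a_def)
  then have "rank R {q \<in> P. c q = a} p \<le> lam a"
    unfolding rank_def Suc_le_eq P(2)[of a, symmetric] using P(1) by (intro psubset_card_mono) auto
  then show *: "rank R P p \<in> subinterval ordD lam (c p)"
    unfolding rank_p a_def[symmetric] subinterval_def by (simp add: rank_def)
  show "diet ordD ordA lam (rank R P p) = rank R P (S p)"
    using diet_on_subinterval[OF ordD *, of ordA] by (simp add: rank_p rank_Sp flip: a_def)
qed

section \<open>Clustering families yield interval exchanges\<close>

text \<open>
  A position \<open>(i, k)\<close> stands for the conjugate of \<open>F ! i\<close> that starts at its letter number \<open>k\<close>.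
\<close>

definition positions :: "'a list list \<Rightarrow> (nat \<times> nat) set" where
  "positions F = (SIGMA i:{..<length F}. {..<length (F ! i)})"

definition letter_of :: "'a list list \<Rightarrow> nat \<times> nat \<Rightarrow> 'a" where
  "letter_of F p = F ! fst p ! snd p"

definition conjugate_at :: "'a list list \<Rightarrow> nat \<times> nat \<Rightarrow> 'a list" where
  "conjugate_at F p = rotate (snd p) (F ! fst p)"

definition next_position :: "'a list list \<Rightarrow> nat \<times> nat \<Rightarrow> nat \<times> nat" where
  "next_position F p = (fst p, Suc (snd p) mod length (F ! fst p))"

text \<open>
  Repeated words of the family have the same conjugates; the index in the family separates them.
\<close>

definition position_less :: "'a rel \<Rightarrow> 'a list list \<Rightarrow> nat \<times> nat \<Rightarrow> nat \<times> nat \<Rightarrow> bool" where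
  "position_less ordD F p q \<longleftrightarrow>
     less_D ordD (conjugate_at F p) (conjugate_at F q) \<or>
     right_power (conjugate_at F p) = right_power (conjugate_at F q) \<and> fst p < fst q"

lemma finite_positions: "finite (positions F)"
  by (simp add: positions_def)

lemma card_positions_letter:
  "card {p \<in> positions F. letter_of F p = a} = (\<Sum>v\<leftarrow>F. parikh v a)"
proof -
  have word: "card {k. k < length w \<and> w ! k = a} = parikh w a" for w
    by (simp add: parikh_def count_list_eq_length_filter length_filter_conv_card eq_commute)
  have "{p \<in> positions F. letter_of F p = a}
      = (SIGMA i:{..<length F}. {k. k < length (F ! i) \<and> F ! i ! k = a})"
    by (auto simp: positions_def letter_of_def)
  then have "card {p \<in> positions F. letter_of F p = a}
      = (\<Sum>i<length F. card {k. k < length (F ! i) \<and> F ! i ! k = a})"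
    by (simp add: card_SigmaI)
  then show ?thesis
    by (simp add: word sum_list_sum_nth lessThan_atLeast0)
qed

lemma next_position_bij: "bij_betw (next_position F) (positions F) (positions F)"
proof -
  have sub: "next_position F ` positions F \<subseteq> positions F"
    by (auto simp: next_position_def positions_def intro!: mod_less_divisor elim: order_le_less_trans[rotated])
  have "inj_on (next_position F) (positions F)"
  proof (rule inj_onI)
    fix p q assume pq: "p \<in> positions F" "q \<in> positions F" "next_position F p = next_position F q"
    then have "fst p = fst q" "snd p < length (F ! fst p)" "snd q < length (F ! fst p)"
        "Suc (snd p) mod length (F ! fst p) = Suc (snd q) mod length (F ! fst p)"
      by (auto simp: next_position_def positions_def)
    then show "p = q"
      by (auto simp: mod_Suc prod_eq_iff split: if_splits)
  qed
  then show ?thesis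
    using endo_inj_surj[OF finite_positions sub] by (simp add: bij_betw_def)
qed

context
  fixes F :: "'a list list" and p :: "nat \<times> nat"
  assumes p: "p \<in> positions F"
begin

lemma conjugate_at_nonempty: "conjugate_at F p \<noteq> []"
  using p by (auto simp: positions_def conjugate_at_def)

lemma conjugate_at_in_conjugates: "conjugate_at F p \<in> conjugates (F ! fst p)"
  by (auto simp: conjugate_at_def conjugates_def)

lemma conjugate_at_next: "conjugate_at F (next_position F p) = rotate1 (conjugate_at F p)"
  by (simp add: conjugate_at_def next_position_def rotate_conv_mod[symmetric])

lemma right_power_head: "right_power (conjugate_at F p) 0 = letter_of F p"
proof -
  have "F ! fst p \<noteq> []" "snd p < length (F ! fst p)"
    using p by (auto simp: positions_def)
  then show ?thesis
    by (simp add: conjugate_at_def letter_of_def right_power_def nth_rotate)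
qed

lemma right_power_next:
  "right_power (conjugate_at F (next_position F p)) n = right_power (conjugate_at F p) (Suc n)"
  using biinf_power_rotate[OF conjugate_at_nonempty, of 1 "int n"]
  by (simp add: right_power_eq_biinf conjugate_at_next ac_simps)

lemma left_power_next_head: "left_power (conjugate_at F (next_position F p)) 0 = letter_of F p"
proof -
  have "left_power (conjugate_at F (next_position F p)) 0 = right_power (conjugate_at F p) 0"
    using biinf_power_rotate[OF conjugate_at_nonempty, of 1 "- 1"] conjugate_at_nonempty
    by (simp add: left_power_eq_biinf right_power_eq_biinf conjugate_at_next)
  then show ?thesis by (simp add: right_power_head)
qed

end

context
  fixes ordD ordA :: "'a::finite rel" and F :: "'a list list"
  assumes ordD: "strict_linear_order ordD" and ordA: "strict_linear_order ordA"
    and primitive: "\<forall>v\<in>set F. primitive v" and clustering: "clustering ordD ordA F"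
begin

lemma position_less_irrefl: "\<not> position_less ordD F p p"
  by (simp add: position_less_def less_D_def lex_less_irrefl[OF ordD])

lemma position_less_trans:
  "position_less ordD F p q \<Longrightarrow> position_less ordD F q r \<Longrightarrow> position_less ordD F p r"
  by (auto simp: position_less_def less_D_def intro: lex_less_trans[OF ordD])

text \<open>Primitivity separates the conjugates of a single word; the index breaks all other ties.\<close>

lemma position_less_total:
  assumes "p \<in> positions F" "q \<in> positions F" "p \<noteq> q"
  shows "position_less ordD F p q \<or> position_less ordD F q p"
proof (rule ccontr)
  assume *: "\<not> ?thesis"
  then have eq: "right_power (conjugate_at F p) = right_power (conjugate_at F q)"
    using lex_less_total[OF ordD] by (auto simp: position_less_def less_D_def)
  with * have fst: "fst p = fst q" by (auto simp: position_less_def)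
  then have "conjugate_at F p = conjugate_at F q"
    using eq by (intro right_power_eq_imp_eq) (simp_all add: conjugate_at_def)
  with fst have "snd p = snd q"
    using assms(1,2) primitive by (intro primitive_rotate_inj[of "F ! fst q"])
      (auto simp: positions_def conjugate_at_def)
  with fst assms(3) show False by (simp add: prod_eq_iff)
qed

lemma position_less_if_letter_less:
  assumes "p \<in> positions F" "q \<in> positions F" "(letter_of F p, letter_of F q) \<in> ordD"
  shows "position_less ordD F p q"
  using assms by (simp add: position_less_def less_D_def lex_less_if_head_less right_power_head)

text \<open>
  The successor of a position reads the letter of that position first when going backwards, so the
  letters in the order \<open>ordA\<close> decide \<open><\<^sub>A\<close> between successors, and clustering turns this into \<open><\<^sub>D\<close>.
\<close>

lemma next_position_less_if_letter_less:
  assumes "p \<in> positions F" "q \<in> positions F" "(letter_of F p, letter_of F q) \<in> ordA"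
  shows "position_less ordD F (next_position F p) (next_position F q)"
proof -
  have next_in: "next_position F p \<in> positions F" "next_position F q \<in> positions F"
    by (rule bij_betw_apply[OF next_position_bij]; fact)+
  have "less_A ordA (conjugate_at F (next_position F p)) (conjugate_at F (next_position F q))"
    using assms by (simp add: less_A_def lex_less_if_head_less left_power_next_head)
  then have "less_D ordD (conjugate_at F (next_position F p)) (conjugate_at F (next_position F q))"
    using clustering next_in conjugate_at_in_conjugates[OF next_in(1)] conjugate_at_in_conjugates[OF next_in(2)]
    unfolding clustering_def by (auto simp: positions_def)
  then show ?thesis by (simp add: position_less_def)
qed

text \<open>
  Passing to the successors deletes the common first letter of the two periodic words, and the index
  in the family, which breaks ties, does not change.
\<close>

lemma next_position_less_iff:
  assumes "p \<in> positions F" "q \<in> positions F" "letter_of F p = letter_of F q"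
  shows "position_less ordD F (next_position F p) (next_position F q) \<longleftrightarrow> position_less ordD F p q"
proof -
  have "right_power (conjugate_at F (next_position F p)) = (\<lambda>n. right_power (conjugate_at F p) (Suc n))"
      "right_power (conjugate_at F (next_position F q)) = (\<lambda>n. right_power (conjugate_at F q) (Suc n))"
    using right_power_next assms(1,2) by blast+
  moreover have head: "right_power (conjugate_at F p) 0 = right_power (conjugate_at F q) 0"
    using assms by (simp add: right_power_head)
  moreover have "right_power (conjugate_at F p) = right_power (conjugate_at F q) \<longleftrightarrow>
      (\<lambda>n. right_power (conjugate_at F p) (Suc n)) = (\<lambda>n. right_power (conjugate_at F q) (Suc n))"
    using head by (metis (no_types, lifting) ext fun_cong not0_implies_Suc)
  moreover have "(letter_of F q, letter_of F q) \<notin> ordD"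
    using ordD by (auto simp: strict_linear_order_on_def irrefl_def)
  ultimately show ?thesis
    using assms lex_less_iff_head_tail[of ordD "right_power (conjugate_at F p)" "right_power (conjugate_at F q)"]
    by (simp add: position_less_def less_D_def right_power_head next_position_def)
qed

text \<open>
  The rank \<open>\<rho>\<close> carries the successor map on positions to the interval exchange. The successor map has one
  cycle for each index of the family, and the point \<open>\<rho> (i, k)\<close> reads the word \<open>F ! i\<close> from its
  letter number \<open>k\<close> on.
\<close>

lemma clustering_imp_decomposes_into:
  "decomposes_into ordD ordA (\<lambda>a. \<Sum>v\<leftarrow>F. parikh v a) F"
proof -
  define lam where "lam = (\<lambda>a. \<Sum>v\<leftarrow>F. parikh v a)"
  define T where "T = diet ordD ordA lam"
  define \<rho> where "\<rho> = rank (position_less ordD F) (positions F)"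
  define f where "f i = \<rho> ` ({i} \<times> {..<length (F ! i)})" for i
  have card_lam: "card {p \<in> positions F. letter_of F p = a} = lam a" for a
    by (simp add: lam_def card_positions_letter)
  have total: "total_length lam = card (positions F)"
    using card_labels[OF finite_positions card_lam, of UNIV] by (simp add: total_length_def)
  have bij_T: "bij T" unfolding T_def by (rule diet_bij[OF ordD ordA])
  have bij_\<rho>: "bij_betw \<rho> (positions F) {1..total_length lam}"
    unfolding \<rho>_def total
    by (rule rank_bij_betw[OF finite_positions])
      (erule (1) position_less_trans | rule position_less_irrefl position_less_total; assumption)+
  have \<rho>: "\<rho> p \<in> subinterval ordD lam (letter_of F p)" "T (\<rho> p) = \<rho> (next_position F p)"
    if "p \<in> positions F" for p
    unfolding \<rho>_def T_def
    by (rule rank_conjugates_to_diet[OF ordD ordA finite_positions card_lam next_position_bij];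
        (fact that | erule (1) position_less_trans
          | rule position_less_irrefl position_less_if_letter_less
              next_position_less_if_letter_less next_position_less_iff; assumption))+
  note letter = letter_at_eq[OF ordD \<rho>(1)] and T = \<rho>(2)
  have len: "0 < length (F ! i)" if "i < length F" for i
    using primitive primitive_imp_nonempty[of "F ! i"] that by auto
  have iter: "int_iterate T n (\<rho> (i, k)) = \<rho> (i, nat ((int k + n) mod int (length (F ! i))))"
    if i: "i < length F" and k: "k < length (F ! i)" for i k n
  proof -
    let ?l = "length (F ! i)"
    let ?g = "\<lambda>n. \<rho> (i, nat ((int k + n) mod int ?l))"
    have "T (?g n) = ?g (n + 1)" for n
    proof -
      have "(i, nat ((int k + n) mod int ?l)) \<in> positions F"
        using i len[OF i] by (simp add: positions_def nat_less_iff)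
      moreover have "Suc (nat ((int k + n) mod int ?l)) mod ?l = nat ((int k + (n + 1)) mod int ?l)"
      proof -
        have "int (Suc (nat ((int k + n) mod int ?l)) mod ?l) = ((int k + n) mod int ?l + 1) mod int ?l"
          using len[OF i] by (simp add: zmod_int ac_simps)
        also have "\<dots> = (int k + (n + 1)) mod int ?l"
          by (simp add: mod_add_left_eq add.assoc)
        finally show ?thesis by simp
      qed
      ultimately show ?thesis by (simp add: T next_position_def)
    qed
    from int_iterate_unique[of T ?g, OF bij_T this] show ?thesis
      using k by simp
  qed
  have orbit: "int_orbit T (\<rho> (i, k)) = f i" if i: "i < length F" and k: "k < length (F ! i)" for i k
  proof (rule set_eqI, rule iffI)
    fix x assume "x \<in> int_orbit T (\<rho> (i, k))"
    then show "x \<in> f i"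
      using len[OF i] by (auto simp: int_orbit_def iter[OF i k] f_def nat_less_iff)
  next
    fix x assume "x \<in> f i"
    then obtain l where l: "x = \<rho> (i, l)" "l < length (F ! i)" by (auto simp: f_def)
    then have "x = int_iterate T (int l - int k) (\<rho> (i, k))"
      by (simp add: iter[OF i k])
    then show "x \<in> int_orbit T (\<rho> (i, k))" by (auto simp: int_orbit_def)
  qed
  have "inj_on f {..<length F}"
  proof (rule inj_onI)
    fix i j assume ij: "i \<in> {..<length F}" "j \<in> {..<length F}" "f i = f j"
    have "\<rho> (i, 0) \<in> f j" using ij len by (auto simp: f_def simp flip: ij(3))
    then obtain l where "\<rho> (i, 0) = \<rho> (j, l)" "l < length (F ! j)" by (auto simp: f_def)
    then show "i = j"
      using bij_\<rho> ij len by (auto simp: bij_betw_def positions_def dest: inj_onD)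
  qed
  moreover have "f ` {..<length F} = int_orbit T ` {1..total_length lam}"
  proof -
    have "int_orbit T ` {1..total_length lam} = (\<lambda>p. int_orbit T (\<rho> p)) ` positions F"
      by (simp only: bij_betw_imp_surj_on[OF bij_\<rho>, symmetric] image_image)
    also have "\<dots> = (\<lambda>p. f (fst p)) ` positions F"
      by (rule image_cong) (auto simp: positions_def orbit)
    also have "\<dots> = f ` {..<length F}"
    proof -
      have "fst ` positions F = {..<length F}"
        using len by (force simp: positions_def image_iff)
      then show ?thesis by (metis image_image)
    qed
    finally show ?thesis by simp
  qed
  moreover have "shift_equivalent (coding ordD ordA lam x) (biinf_power (F ! i))"
    if i: "i < length F" and x: "x \<in> f i" for i x
  proof -
    obtain k where k: "x = \<rho> (i, k)" "k < length (F ! i)" using x by (auto simp: f_def)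
    have "coding ordD ordA lam x n = biinf_power (F ! i) (n + int k)" for n
    proof -
      have "(i, nat ((int k + n) mod int (length (F ! i)))) \<in> positions F"
        using i len[OF i] by (simp add: positions_def nat_less_iff)
      then show ?thesis
        using iter[OF i k(2), of n]
        by (simp add: coding_def k(1) letter letter_of_def biinf_power_def ac_simps flip: T_def)
    qed
    then show ?thesis by (auto simp: shift_equivalent_def)
  qed
  ultimately show ?thesis
    unfolding decomposes_into_def bij_betw_def lam_def[symmetric] T_def[symmetric] by blast
qed

end

theorem proposition1:
  fixes k :: nat and ordD ordA :: "'a::finite rel"
  assumes "card (UNIV :: 'a set) = k"
    and "strict_linear_order ordD" and "strict_linear_order ordA" and "ordD \<noteq> ordA"
  shows
    "(\<forall>F :: 'a list list.
        F \<noteq> [] \<and> (\<forall>v\<in>set F. primitive v) \<and> clustering ordD ordA F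
        \<longrightarrow> decomposes_into ordD ordA (\<lambda>a. \<Sum>v\<leftarrow>F. parikh v a) F) \<and>
     (\<forall>(lam :: 'a \<Rightarrow> nat) (F :: 'a list list).
        total_length lam \<ge> 1 \<and> (\<forall>v\<in>set F. primitive v) \<and> decomposes_into ordD ordA lam F
        \<longrightarrow> clustering ordD ordA F)"
  using clustering_imp_decomposes_into[OF assms(2,3)]
    decomposes_into_imp_clustering[OF assms(2,3)] primitive_imp_nonempty
  by blast

end
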